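(* For all integers $n\ge 0$, $$F(n;n,0)=1,$$ $$F(n+2;n,0)=\tfrac12(n+1)(n+4),$$ $$F(n+4;n,0)=\tfrac1{12}(n+1)(n^3+15n^2+74n+132),$$ $$F(n+6;n,0)=\tfrac1{144}(n+1)(n^5+32n^4+407n^3+2620n^2+8604n+12240).$$ More generally, for every integer $k\ge 0$ there is a polynomial $s_k(n)$ in $n$, of degree $2k$ with leading coefficient $\frac{1}{k!\,(k+1)!}$, such that $$F(n+2k;n,0)=s_k(n)\quad\text{for all integers } n\ge 0,$$ and $s_k(n)$ is divisible by $n+1$ for $k\ge 1$.
   Context: For integers $m\ge 0$ and $n_1,n_2$, $F(m;n_1,n_2)$ denotes the number of Gessel walks with exactly $m$ steps from $(0,0)$ to $(n_1,n_2)$: lattice walks starting at the origin, each of whose $m$ steps is one of West $(-1,0)$, North-East $(1,1)$, East $(1,0)$, South-West $(-1,-1)$, and which remain in the first quadrant $\{(i,j): i\ge 0, j\ge 0\}$. In particular $F(m;n_1,n_2)=0$ if $n_1<0$ or $n_2<0$, and $F(0;n_1,n_2)=1$ if $n_1=n_2=0$ and $0$ otherwise. Polynomials have rational coefficients and divisibility is in $\mathbb{Q}[n]$. *)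

theory Defs
  imports
    "HOL-Library.Product_Plus"
    "HOL-Computational_Algebra.Polynomial"
begin

definition gessel_steps :: "(int \<times> int) set" where
  "gessel_steps = {(-1, 0), (1, 1), (1, 0), (-1, -1)}"

text \<open>A walk is represented by its list of steps; the points it visits are the
  componentwise partial sums of that list, the starting point being the origin.\<close>

definition gessel_walk :: "(int \<times> int) list \<Rightarrow> bool" where
  "gessel_walk w \<longleftrightarrow>
     set w \<subseteq> gessel_steps \<and>
     (\<forall>k\<le>length w. sum_list (take k w) \<in> {(i, j). 0 \<le> i \<and> 0 \<le> j})"

definition F :: "nat \<Rightarrow> int \<Rightarrow> int \<Rightarrow> nat" where
  "F m n1 n2 = card {w. length w = m \<and> gessel_walk w \<and> sum_list w = (n1, n2)}"

end

(* Sort the walks to (n, j) by their number k of westward steps, so that they have n + 2k steps,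
   and let f_k(n, j) count them. Removing the last step gives
     f_k(n, j) - f_k(n-1, j) = f_k(n-1, j-1) + f_{k-1}(n+1, j) + f_{k-1}(n+1, j+1).
   Summing over n, by induction on k and then on j, f_k(n, j) is a polynomial in n of degree
   2k + j. For k > 0 the recurrence also holds at n = 0 with f_k(-1, j) = 0, so the polynomial
   vanishes at -1; for j = 0 this is the factor n + 1. *)
theory Submission
  imports Defs
begin

section \<open>Walks and the removal of their last step\<close>

lemma gessel_walk_snoc:
  "gessel_walk (w @ [s]) \<longleftrightarrow> gessel_walk w \<and> s \<in> gessel_steps \<and>
     0 \<le> fst (sum_list w + s) \<and> 0 \<le> snd (sum_list w + s)"
proof -
  have "p \<in> {(i, j). 0 \<le> i \<and> 0 \<le> j} \<longleftrightarrow> 0 \<le> fst p \<and> 0 \<le> snd p" for p :: "int \<times> int"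
    by (cases p) simp
  then show ?thesis
    unfolding gessel_walk_def by (auto simp: le_Suc_eq simp del: fst_add snd_add)
qed

definition walks :: "nat \<Rightarrow> int \<times> int \<Rightarrow> (int \<times> int) list set" where
  "walks m p = {w. length w = m \<and> gessel_walk w \<and> sum_list w = p}"

lemma F_eq_card_walks: "F m i j = card (walks m (i, j))"
  by (simp add: F_def walks_def)

lemma finite_walks: "finite (walks m p)"
proof (rule finite_subset)
  show "walks m p \<subseteq> {w. set w \<subseteq> gessel_steps \<and> length w = m}"
    by (auto simp: walks_def gessel_walk_def)
  show "finite {w. set w \<subseteq> gessel_steps \<and> length w = m}"
    by (rule finite_lists_length_eq) (simp add: gessel_steps_def)
qed

text \<open>Cutting off the last step \<open>s\<close> leaves a walk ending at \<open>p - s\<close>.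
  Conversely, appending \<open>s\<close> adds only the new endpoint \<open>p\<close> to the points
  visited, which is why \<open>p\<close> must lie in the quadrant.\<close>

lemma walks_Suc:
  assumes "0 \<le> fst p" "0 \<le> snd p"
  shows "walks (Suc m) p = (\<Union>s\<in>gessel_steps. (\<lambda>w. w @ [s]) ` walks m (p - s))"
proof (intro equalityI subsetI)
  fix v assume "v \<in> walks (Suc m) p"
  then have v: "length v = Suc m" "gessel_walk v" "sum_list v = p"
    by (auto simp: walks_def)
  obtain w s where ws: "v = w @ [s]"
    using v(1) by (cases v rule: rev_cases) auto
  with v have "w \<in> walks m (p - s)" "s \<in> gessel_steps"
    by (auto simp: walks_def gessel_walk_snoc)
  with ws show "v \<in> (\<Union>s\<in>gessel_steps. (\<lambda>w. w @ [s]) ` walks m (p - s))"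
    by blast
next
  fix v assume "v \<in> (\<Union>s\<in>gessel_steps. (\<lambda>w. w @ [s]) ` walks m (p - s))"
  then show "v \<in> walks (Suc m) p"
    using assms by (auto simp: walks_def gessel_walk_snoc)
qed

lemma F_Suc:
  assumes "0 \<le> i" "0 \<le> j"
  shows "F (Suc m) i j =
    F m (i + 1) j + F m (i - 1) (j - 1) + F m (i - 1) j + F m (i + 1) (j + 1)"
proof -
  \<comment> \<open>The union is disjoint because its members are told apart by their last
    step.\<close>
  have "F (Suc m) i j = (\<Sum>s\<in>gessel_steps. card ((\<lambda>w. w @ [s]) ` walks m ((i, j) - s)))"
    unfolding F_eq_card_walks
    by (subst walks_Suc, use assms in simp, use assms in simp, subst card_UN_disjoint)
      (auto simp: gessel_steps_def finite_walks)
  also have "\<dots> = (\<Sum>s\<in>gessel_steps. card (walks m ((i, j) - s)))"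
    by (intro sum.cong refl card_image) (auto simp: inj_on_def)
  finally show ?thesis
    by (simp add: gessel_steps_def F_eq_card_walks)
qed

lemma F_neg:
  assumes "i < 0 \<or> j < 0"
  shows "F m i j = 0"
proof -
  have "\<not> (gessel_walk w \<and> sum_list w = (i, j))" for w
    using assms unfolding gessel_walk_def by (auto dest!: spec[of _ "length w"])
  then have "{w. length w = m \<and> gessel_walk w \<and> sum_list w = (i, j)} = {}"
    by blast
  then show ?thesis
    by (simp only: F_def card.empty)
qed

lemma F_0: "F 0 i j = (if i = 0 \<and> j = 0 then 1 else 0)"
proof -
  have "{w. length w = 0 \<and> gessel_walk w \<and> sum_list w = (i, j)} =
      (if i = 0 \<and> j = 0 then {[]} else {})"
    by (auto simp: gessel_walk_def zero_prod_def)
  then show ?thesis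
    by (simp add: F_def)
qed

text \<open>A step raises the first coordinate by at most one. At \<open>k = 0\<close> this removes
  the westward terms from the recurrence.\<close>

lemma F_far: "int m < i \<Longrightarrow> F m i j = 0"
proof (induction m arbitrary: i j)
  case (Suc m)
  then show ?case
    by (cases "0 \<le> j") (auto simp: F_Suc F_neg)
qed (auto simp: F_0)

section \<open>Recurrences for the counts by westward steps\<close>

text \<open>Every step moves horizontally by one, so \<open>k\<close> is the number of westward steps.\<close>

definition diag :: "nat \<Rightarrow> nat \<Rightarrow> nat \<Rightarrow> rat" where
  "diag k n j = of_nat (F (n + 2 * k) (int n) (int j))"

lemma diag_0_0: "diag 0 0 j = (if j = 0 then 1 else 0)"
  by (simp add: diag_def F_0)

lemma diag_0_Suc_0: "diag 0 (Suc n) 0 = diag 0 n 0"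
  by (simp add: diag_def F_Suc F_neg F_far)

lemma diag_0_Suc_add: "diag 0 (Suc n) (j + 1) = diag 0 n (j + 1) + diag 0 n j"
  by (simp add: diag_def F_Suc F_far)

text \<open>A walk ending in column 0 cannot end with an eastward step. This is the general
  recurrence with the counts in column -1 read as zero.\<close>

lemma diag_add_0: "diag (k + 1) 0 j = diag k 1 j + diag k 1 (j + 1)"
  by (simp add: diag_def F_Suc F_neg add_ac)

lemma diag_add_Suc_0:
  "diag (k + 1) (Suc n) 0 = diag (k + 1) n 0 + diag k (n + 2) 0 + diag k (n + 2) 1"
  using F_Suc[of "int (Suc n)" 0 "n + 2 * (k + 1)"]
  by (simp add: diag_def F_neg add_ac)

lemma diag_add_Suc_add:
  "diag (k + 1) (Suc n) (j + 1) = diag (k + 1) n (j + 1) + diag (k + 1) n j +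
     diag k (n + 2) (j + 1) + diag k (n + 2) (j + 2)"
  using F_Suc[of "int (Suc n)" "int (j + 1)" "n + 2 * (k + 1)"]
  by (simp add: diag_def F_neg add_ac)

section \<open>Closed forms for k at most 3\<close>

lemma diag_0_zero: "diag 0 n 0 = 1"
proof (induction n)
  case (Suc n)
  then show ?case using diag_0_Suc_0[of n] by simp
qed (simp add: diag_0_0)

text \<open>Without westward steps, a walk is a choice of which j of its n steps are North-East, so
  the values at \<open>k = 0\<close> are binomial coefficients.\<close>

lemma diag_0_one: "diag 0 n 1 = of_nat n"
proof (induction n)
  case 0
  show ?case by (simp add: diag_0_0)
next
  case (Suc n)
  then show ?case
    using diag_0_Suc_add[of n 0]
    by (simp add: diag_0_zero field_simps power_numeral_reduce
          del: One_nat_def add_2_eq_Suc add_2_eq_Suc')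
qed

lemma diag_0_two: "diag 0 n 2 = of_nat n * (of_nat n - 1) / 2"
proof (induction n)
  case 0
  show ?case by (simp add: diag_0_0)
next
  case (Suc n)
  then show ?case
    using diag_0_Suc_add[of n 1]
    by (simp add: diag_0_one field_simps power_numeral_reduce
          del: One_nat_def add_2_eq_Suc add_2_eq_Suc')
qed

lemma diag_0_three: "diag 0 n 3 = of_nat n * (of_nat n - 1) * (of_nat n - 2) / 6"
proof (induction n)
  case 0
  show ?case by (simp add: diag_0_0)
next
  case (Suc n)
  then show ?case
    using diag_0_Suc_add[of n 2]
    by (simp add: diag_0_two field_simps power_numeral_reduce
          del: One_nat_def add_2_eq_Suc add_2_eq_Suc')
qed

text \<open>The form at (k, j) rests on those at (k-1, j), (k-1, j+1) and, for j > 0, (k, j-1).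
  Hence (3, 0) calls for all pairs with k + j at most 3.\<close>

lemma diag_1_zero: "diag 1 n 0 = 1/2 * (of_nat n + 1) * (of_nat n + 4)"
proof (induction n)
  case 0
  show ?case
    using diag_add_0[of 0 0]
    by (simp add: diag_0_zero diag_0_one power2_eq_square del: One_nat_def)
next
  case (Suc n)
  then show ?case
    using diag_add_Suc_0[of 0 n]
    by (simp add: diag_0_zero diag_0_one field_simps power_numeral_reduce
          del: One_nat_def add_2_eq_Suc add_2_eq_Suc')
qed

lemma diag_1_one:
  "diag 1 n 1 = 1/3 * (of_nat n + 1) * (of_nat n ^ 2 + 5 * of_nat n + 3)"
proof (induction n)
  case 0
  show ?case
    using diag_add_0[of 0 1]
    by (simp add: diag_0_one diag_0_two power2_eq_square del: One_nat_def)
next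
  case (Suc n)
  then show ?case
    using diag_add_Suc_add[of 0 n 0]
    by (simp add: diag_1_zero diag_0_one diag_0_two field_simps power_numeral_reduce
          del: One_nat_def add_2_eq_Suc add_2_eq_Suc')
qed

lemma diag_1_two:
  "diag 1 n 2 = 1/8 * of_nat n * (of_nat n + 1) * (of_nat n ^ 2 + 5 * of_nat n + 2)"
proof (induction n)
  case 0
  show ?case
    using diag_add_0[of 0 2]
    by (simp add: diag_0_two diag_0_three power2_eq_square del: One_nat_def)
next
  case (Suc n)
  then show ?case
    using diag_add_Suc_add[of 0 n 1]
    by (simp add: diag_1_one diag_0_two diag_0_three field_simps power_numeral_reduce
          del: One_nat_def add_2_eq_Suc add_2_eq_Suc')
qed

lemma diag_2_zero:
  "diag 2 n 0 = 1/12 * (of_nat n + 1) * (of_nat n ^ 3 + 15 * of_nat n ^ 2 + 74 * of_nat n + 132)"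
proof (induction n)
  case 0
  show ?case
    using diag_add_0[of 1 0]
    by (simp add: diag_1_zero diag_1_one power2_eq_square del: One_nat_def)
next
  case (Suc n)
  then show ?case
    using diag_add_Suc_0[of 1 n]
    by (simp add: diag_1_zero diag_1_one field_simps power_numeral_reduce
          del: One_nat_def add_2_eq_Suc add_2_eq_Suc')
qed

lemma diag_2_one:
  "diag 2 n 1 = 1/24 * (of_nat n + 1) *
     (of_nat n ^ 4 + 17 * of_nat n ^ 3 + 102 * of_nat n ^ 2 + 264 * of_nat n + 192)"
proof (induction n)
  case 0
  show ?case
    using diag_add_0[of 1 1]
    by (simp add: diag_1_one diag_1_two power2_eq_square del: One_nat_def)
next
  case (Suc n)
  then show ?case
    using diag_add_Suc_add[of 1 n 0]
    by (simp add: diag_2_zero diag_1_one diag_1_two field_simps power_numeral_reduce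
          del: One_nat_def add_2_eq_Suc add_2_eq_Suc')
qed

lemma diag_3_zero:
  "diag 3 n 0 = 1/144 * (of_nat n + 1) *
     (of_nat n ^ 5 + 32 * of_nat n ^ 4 + 407 * of_nat n ^ 3
       + 2620 * of_nat n ^ 2 + 8604 * of_nat n + 12240)"
proof (induction n)
  case 0
  show ?case
    using diag_add_0[of 2 0]
    by (simp add: diag_2_zero diag_2_one power2_eq_square del: One_nat_def)
next
  case (Suc n)
  then show ?case
    using diag_add_Suc_0[of 2 n]
    by (simp add: diag_2_zero diag_2_one field_simps power_numeral_reduce
          del: One_nat_def add_2_eq_Suc add_2_eq_Suc')
qed

section \<open>Rising factorials and antidifferences of polynomials\<close>

lemma coeff_pcompose_linear_top:
  fixes p :: "'a::idom poly"
  assumes "degree p \<le> d"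
  shows "coeff (pcompose p [:c, 1:]) d = coeff p d"
proof (cases "degree p = d")
  case True
  then show ?thesis
    using lead_coeff_comp[of "[:c, 1:]" p] by (simp add: degree_pcompose)
next
  case False
  with assms show ?thesis
    by (simp add: coeff_eq_0 degree_pcompose)
qed

text \<open>Both rising factorials contain \<open>pochhammer x d\<close>; the remaining factors
  \<open>x + d\<close> and \<open>x - 1\<close> differ by \<open>d + 1\<close>. Rising factorials
  thus play the part of monomials for the backward difference.\<close>

lemma pochhammer_backward_diff:
  fixes x :: "'a::comm_ring_1"
  shows "pochhammer x (Suc d) - pochhammer (x - 1) (Suc d) = of_nat (Suc d) * pochhammer x d"
  by (simp only: pochhammer_Suc[of x] pochhammer_rec[of "x - 1"]) (simp add: algebra_simps)

lemma pochhammer_X: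
  fixes x :: "'a::field_char_0"
  shows "poly (pochhammer [:0, 1:] d) x = pochhammer x d"
    and "degree (pochhammer [:0, 1 :: 'a:] d) = d"
    and "coeff (pochhammer [:0, 1 :: 'a:] d) d = 1"
proof -
  show "poly (pochhammer [:0, 1:] d) x = pochhammer x d"
    by (induction d) (simp_all add: pochhammer_Suc algebra_simps)
  have "lead_coeff (pochhammer [:0, 1 :: 'a:] d) = 1 \<and> degree (pochhammer [:0, 1 :: 'a:] d) = d"
  proof (induction d)
    case (Suc d)
    have "pochhammer [:0, 1 :: 'a:] (Suc d) = pochhammer [:0, 1:] d * [:of_nat d, 1:]"
      by (simp only: pochhammer_Suc) (simp add: of_nat_poly)
    moreover have "pochhammer [:0, 1 :: 'a:] d \<noteq> 0"
      using Suc by auto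
    ultimately show ?case
      using Suc lead_coeff_mult[of "pochhammer [:0, 1:] d" "[:of_nat d, 1 :: 'a:]"]
      by (auto simp: degree_mult_eq simp del: mult_pCons_right)
  qed simp
  then show "degree (pochhammer [:0, 1 :: 'a:] d) = d" "coeff (pochhammer [:0, 1 :: 'a:] d) d = 1"
    by auto
qed

text \<open>Rising factorials are summed one at a time from the top degree down; the free additive
  constant then fixes the value at \<open>a\<close>. Coefficients are taken at the bound
  \<open>d\<close>, so the degree of \<open>p\<close> may be smaller.\<close>

lemma ex_antidifference:
  fixes p :: "'a::field_char_0 poly"
  assumes "degree p \<le> d"
  obtains q where "degree q \<le> Suc d" "coeff q (Suc d) = coeff p d / of_nat (Suc d)"
    "\<And>x. poly q x - poly q (x - 1) = poly p x" "poly q a = b"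
proof -
  have "\<exists>q. degree q \<le> Suc d \<and> coeff q (Suc d) = coeff p d / of_nat (Suc d) \<and>
      (\<forall>x. poly q x - poly q (x - 1) = poly p x)"
    using assms
  proof (induction d arbitrary: p)
    case 0
    then obtain c where p: "p = [:c:]"
      by (auto elim: degree_eq_zeroE)
    show ?case
      by (rule exI[of _ "[:0, c:]"]) (simp add: p algebra_simps)
  next
    case (Suc d)
    define c where "c = coeff p (Suc d)"
    define R :: "nat \<Rightarrow> 'a poly" where "R = pochhammer [:0, 1:]"
    have R: "degree (R n) = n" "coeff (R n) n = 1" "poly (R n) x = pochhammer x n" for n x
      by (simp_all add: R_def pochhammer_X)
    \<comment> \<open>\<open>R (Suc d)\<close> is monic, so the subtraction cancels the top
      coefficient.\<close>
    have "degree (p - smult c (R (Suc d))) \<le> d"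
    proof (rule degree_le, intro allI impI)
      fix i assume "d < i"
      then consider "i = Suc d" | "Suc d < i" by linarith
      then show "coeff (p - smult c (R (Suc d))) i = 0"
        using Suc.prems by cases (simp_all add: c_def R coeff_eq_0)
    qed
    from Suc.IH[OF this] obtain q where q: "degree q \<le> Suc d"
      "\<And>x. poly q x - poly q (x - 1) = poly (p - smult c (R (Suc d))) x" by blast
    \<comment> \<open>The added term has backward difference \<open>c * R (Suc d)\<close>, the part
      that was split off.\<close>
    define r where "r = q + smult (c / of_nat (Suc (Suc d))) (R (Suc (Suc d)))"
    have "degree r \<le> Suc (Suc d)"
      unfolding r_def using q(1) by (intro degree_add_le) (auto simp: R)
    moreover have "coeff r (Suc (Suc d)) = c / of_nat (Suc (Suc d))"
      using q(1) by (simp add: r_def R coeff_eq_0)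
    moreover have "poly r x - poly r (x - 1) = poly p x" for x
    proof -
      have "poly r x - poly r (x - 1) = poly p x - c * pochhammer x (Suc d) +
          c / of_nat (Suc (Suc d)) *
            (pochhammer x (Suc (Suc d)) - pochhammer (x - 1) (Suc (Suc d)))"
        using q(2)[of x] unfolding r_def by (simp add: R algebra_simps)
      also have "\<dots> = poly p x"
        unfolding pochhammer_backward_diff by (simp del: of_nat_Suc)
      finally show ?thesis .
    qed
    ultimately show ?case
      unfolding c_def by blast
  qed
  then obtain q where q: "degree q \<le> Suc d" "coeff q (Suc d) = coeff p d / of_nat (Suc d)"
    "\<And>x. poly q x - poly q (x - 1) = poly p x"
    by blast
  show ?thesis
  proof (rule that[of "q + [:b - poly q a:]"])
    show "degree (q + [:b - poly q a:]) \<le> Suc d"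
      using q(1) by (intro degree_add_le) auto
  qed (use q in auto)
qed

lemma poly_eqI_backward_diff:
  fixes f :: "nat \<Rightarrow> 'a::comm_ring_1"
  assumes "f 0 = poly q 0"
    and "\<And>n. f (Suc n) - f n = poly q (of_nat (Suc n)) - poly q (of_nat n)"
  shows "f n = poly q (of_nat n)"
proof (induction n)
  case (Suc n)
  then show ?case using assms(2)[of n] by simp
qed (use assms(1) in simp)

section \<open>Polynomiality and leading coefficients\<close>

text \<open>The solution, with value \<open>1 / j!\<close> at \<open>k = 0\<close>, of the recurrence
  \<open>(j + 2 k) c(k, j) = c(k, j - 1) + c(k - 1, j + 1)\<close> for the leading coefficients.\<close>

definition top_coeff :: "nat \<Rightarrow> nat \<Rightarrow> rat" where
  "top_coeff k j = (of_nat j + 1) / (fact k * fact (j + k + 1))"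

text \<open>This and the next two lemmas are the recurrence at k = 0, at j = 0, and with both
  positive. Multiplied by (2k + j)!, the coefficients become the ballot numbers.\<close>

lemma top_coeff_0_Suc: "top_coeff 0 j / of_nat (Suc j) = top_coeff 0 (Suc j)"
  by (simp add: top_coeff_def divide_simps)

lemma top_coeff_Suc_0: "top_coeff k 1 / of_nat (2 * k + 2) = top_coeff (Suc k) 0"
  by (simp add: top_coeff_def divide_simps)

lemma top_coeff_Suc_Suc:
  "(top_coeff (Suc k) j + top_coeff k (j + 2)) / of_nat (2 * k + j + 3) = top_coeff (Suc k) (Suc j)"
  by (simp add: top_coeff_def divide_simps) (simp add: algebra_simps)

text \<open>An induction invariant. The root -1 is demanded at every height j, because the step in j
  uses it; at k = j = 0 the polynomial is 1, hence the restriction to positive k.\<close>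

definition diag_poly :: "nat \<Rightarrow> nat \<Rightarrow> rat poly \<Rightarrow> bool" where
  "diag_poly k j s \<longleftrightarrow> degree s \<le> 2 * k + j \<and> coeff s (2 * k + j) = top_coeff k j \<and>
     (\<forall>n. diag k n j = poly s (of_nat n)) \<and> (k \<ge> 1 \<longrightarrow> poly s (-1) = 0)"

lemma ex_diag_poly_0: "\<exists>s. diag_poly 0 j s"
proof (induction j)
  case 0
  have "diag_poly 0 0 1"
    by (simp add: diag_poly_def top_coeff_def diag_0_zero)
  then show ?case ..
next
  case (Suc j)
  then obtain p where p: "diag_poly 0 j p" ..
  have deg: "degree (pcompose p [:-1, 1:]) \<le> j"
    using p by (simp add: diag_poly_def degree_pcompose)
  \<comment> \<open>The increment from n-1 to n is the count at height j in column n-1, hence the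
    shift by -1. The value 0 at 0 comes from \<open>diag_0_0\<close>.\<close>
  obtain q where q: "degree q \<le> Suc j"
    "coeff q (Suc j) = coeff (pcompose p [:-1, 1:]) j / of_nat (Suc j)"
    "\<And>x. poly q x - poly q (x - 1) = poly (pcompose p [:-1, 1:]) x" "poly q 0 = 0"
    using ex_antidifference[OF deg] by metis
  have "diag 0 n (Suc j) = poly q (of_nat n)" for n
  proof (rule poly_eqI_backward_diff)
    fix n
    show "diag 0 (Suc n) (Suc j) - diag 0 n (Suc j) = poly q (of_nat (Suc n)) - poly q (of_nat n)"
      using diag_0_Suc_add[of n j] q(3)[of "of_nat (Suc n)"] p
      by (simp add: diag_poly_def poly_pcompose)
  qed (simp add: diag_0_0 q)
  moreover have "coeff q (Suc j) = top_coeff 0 (Suc j)"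
    using p by (simp add: q(2) coeff_pcompose_linear_top diag_poly_def top_coeff_0_Suc del: of_nat_Suc)
  ultimately have "diag_poly 0 (Suc j) q"
    using q by (simp add: diag_poly_def)
  then show ?case ..
qed

text \<open>The hypothesis for k must cover all heights, since each step upwards in j at k + 1 draws
  on greater heights at k.\<close>

lemma ex_diag_poly: "\<exists>s. diag_poly k j s"
proof (induction k arbitrary: j)
  case 0
  show ?case by (rule ex_diag_poly_0)
next
  case (Suc k)
  note IH = Suc.IH
  show ?case
  proof (induction j)
    case 0
    obtain p where p: "diag_poly k 0 p" using IH by blast
    obtain r where r: "diag_poly k 1 r" using IH by blast
    define t where "t = pcompose p [:1, 1:] + pcompose r [:1, 1:]"
    have deg: "degree p \<le> 2 * k + 1" "degree p < 2 * k + 1" "degree r \<le> 2 * k + 1"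
      using p r by (auto simp: diag_poly_def)
    have "degree t \<le> 2 * k + 1"
      unfolding t_def using deg by (intro degree_add_le) (auto simp: degree_pcompose)
    then obtain q where q: "degree q \<le> Suc (2 * k + 1)"
      "coeff q (Suc (2 * k + 1)) = coeff t (2 * k + 1) / of_nat (Suc (2 * k + 1))"
      "\<And>x. poly q x - poly q (x - 1) = poly t x" "poly q (-1) = 0"
      using ex_antidifference by metis
    have t: "poly t (of_nat n) = diag k (n + 1) 0 + diag k (n + 1) 1" for n
      using p r by (simp add: t_def diag_poly_def poly_pcompose add_ac)
    have "diag (Suc k) n 0 = poly q (of_nat n)" for n
    proof (rule poly_eqI_backward_diff)
      \<comment> \<open>As \<open>q\<close> vanishes at -1, its value at 0 is
        \<open>poly t 0\<close>, which agrees with \<open>diag_add_0\<close>.\<close>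
      show "diag (Suc k) 0 0 = poly q 0"
        using q(3)[of 0] q(4) t[of 0] diag_add_0[of k 0] by simp
      fix n
      show "diag (Suc k) (Suc n) 0 - diag (Suc k) n 0 = poly q (of_nat (Suc n)) - poly q (of_nat n)"
        using diag_add_Suc_0[of k n] q(3)[of "of_nat (Suc n)"] t[of "Suc n"] by simp
    qed
    moreover have "coeff q (2 * Suc k) = top_coeff (Suc k) 0"
    proof -
      have "coeff t (2 * k + 1) = top_coeff k 1"
        using r deg unfolding t_def coeff_add
        by (simp only: coeff_pcompose_linear_top coeff_eq_0 diag_poly_def)
      then show ?thesis
        using q(2) top_coeff_Suc_0[of k] by simp
    qed
    ultimately have "diag_poly (Suc k) 0 q"
      using q by (simp add: diag_poly_def)
    then show ?case ..
  next
    case (Suc j)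
    then obtain u where u: "diag_poly (Suc k) j u" ..
    obtain p where p: "diag_poly k (j + 1) p" using IH by blast
    obtain r where r: "diag_poly k (j + 2) r" using IH by blast
    \<comment> \<open>The degree bound shared by \<open>u\<close> and \<open>r\<close>; that of
      \<open>p\<close> is one less, so \<open>p\<close> does not enter the top coefficient.\<close>
    define d where "d = 2 * k + j + 2"
    define t where "t = pcompose u [:-1, 1:] + (pcompose p [:1, 1:] + pcompose r [:1, 1:])"
    have deg: "degree u \<le> d" "degree p \<le> d" "degree p < d" "degree r \<le> d"
      using u p r by (auto simp: diag_poly_def d_def)
    have "degree t \<le> d"
      unfolding t_def using deg by (intro degree_add_le) (auto simp: degree_pcompose)
    then obtain q where q: "degree q \<le> Suc d" "coeff q (Suc d) = coeff t d / of_nat (Suc d)"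
      "\<And>x. poly q x - poly q (x - 1) = poly t x" "poly q (-1) = 0"
      using ex_antidifference by metis
    have t: "poly t (of_nat n) =
        poly u (of_nat n - 1) + diag k (n + 1) (j + 1) + diag k (n + 1) (j + 2)" for n
      using p r by (simp add: t_def diag_poly_def poly_pcompose add_ac)
    have u0: "poly u (-1) = 0" "diag (Suc k) n j = poly u (of_nat n)" for n
      using u by (auto simp: diag_poly_def)
    have "diag (Suc k) n (Suc j) = poly q (of_nat n)" for n
    proof (rule poly_eqI_backward_diff)
      \<comment> \<open>Here \<open>t\<close> at 0 contains \<open>u\<close> at -1, a term absent
        from \<open>diag_add_0\<close>; the root of \<open>u\<close> makes it vanish.\<close>
      show "diag (Suc k) 0 (Suc j) = poly q 0"
        using q(3)[of 0] q(4) t[of 0] diag_add_0[of k "Suc j"] u0(1) by simp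
      fix n
      show "diag (Suc k) (Suc n) (Suc j) - diag (Suc k) n (Suc j) =
          poly q (of_nat (Suc n)) - poly q (of_nat n)"
        using diag_add_Suc_add[of k n j] q(3)[of "of_nat (Suc n)"] t[of "Suc n"] u0(2)[of n]
        by simp
    qed
    moreover have "coeff q (2 * Suc k + Suc j) = top_coeff (Suc k) (Suc j)"
    proof -
      have "coeff t d = top_coeff (Suc k) j + top_coeff k (j + 2)"
        using u r deg unfolding t_def coeff_add
        by (simp add: coeff_pcompose_linear_top coeff_eq_0 diag_poly_def d_def)
      then show ?thesis
        using q(2) top_coeff_Suc_Suc[of k j] by (simp add: d_def numeral_3_eq_3)
    qed
    ultimately have "diag_poly (Suc k) (Suc j) q"
      using q by (simp add: diag_poly_def d_def)
    then show ?case ..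
  qed
qed

theorem corollary6:
  shows "(\<forall>n::nat.
            (of_nat (F n (int n) 0) :: rat) = 1 \<and>
            (of_nat (F (n + 2) (int n) 0) :: rat) =
              1/2 * (of_nat n + 1) * (of_nat n + 4) \<and>
            (of_nat (F (n + 4) (int n) 0) :: rat) =
              1/12 * (of_nat n + 1) *
                (of_nat n ^ 3 + 15 * of_nat n ^ 2 + 74 * of_nat n + 132) \<and>
            (of_nat (F (n + 6) (int n) 0) :: rat) =
              1/144 * (of_nat n + 1) *
                (of_nat n ^ 5 + 32 * of_nat n ^ 4 + 407 * of_nat n ^ 3
                  + 2620 * of_nat n ^ 2 + 8604 * of_nat n + 12240))
       \<and> (\<forall>k::nat. \<exists>s :: rat poly.
            degree s = 2 * k \<and>
            lead_coeff s = 1 / (fact k * fact (k + 1)) \<and>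
            (\<forall>n::nat. of_nat (F (n + 2 * k) (int n) 0) = poly s (of_nat n)) \<and>
            (k \<ge> 1 \<longrightarrow> [:1, 1:] dvd s))"
proof (intro conjI allI)
  fix n :: nat
  show "(of_nat (F n (int n) 0) :: rat) = 1"
    using diag_0_zero[of n] by (simp add: diag_def)
  show "(of_nat (F (n + 2) (int n) 0) :: rat) = 1/2 * (of_nat n + 1) * (of_nat n + 4)"
    using diag_1_zero[of n] by (simp add: diag_def)
  show "(of_nat (F (n + 4) (int n) 0) :: rat) =
      1/12 * (of_nat n + 1) *
        (of_nat n ^ 3 + 15 * of_nat n ^ 2 + 74 * of_nat n + 132)"
    using diag_2_zero[of n] by (simp add: diag_def)
  show "(of_nat (F (n + 6) (int n) 0) :: rat) =
      1/144 * (of_nat n + 1) *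
        (of_nat n ^ 5 + 32 * of_nat n ^ 4 + 407 * of_nat n ^ 3
          + 2620 * of_nat n ^ 2 + 8604 * of_nat n + 12240)"
    using diag_3_zero[of n] by (simp add: diag_def)
next
  fix k :: nat
  obtain s where s: "diag_poly k 0 s"
    using ex_diag_poly by blast
  have c: "coeff s (2 * k) = 1 / (fact k * fact (k + 1))"
    using s by (simp add: diag_poly_def top_coeff_def)
  \<comment> \<open>A nonzero coefficient at the bound turns the degree bound into an
    equality.\<close>
  then have "coeff s (2 * k) \<noteq> 0"
    by simp
  then have "degree s = 2 * k"
    using s le_degree[of s "2 * k"] by (simp add: diag_poly_def)
  then show "\<exists>s :: rat poly. degree s = 2 * k \<and>
      lead_coeff s = 1 / (fact k * fact (k + 1)) \<and>
      (\<forall>n::nat. of_nat (F (n + 2 * k) (int n) 0) = poly s (of_nat n)) \<and>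
      (k \<ge> 1 \<longrightarrow> [:1, 1:] dvd s)"
    using s c by (intro exI[of _ s]) (auto simp: diag_poly_def diag_def poly_eq_0_iff_dvd)
qed

end
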